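(* Let $D_x, D_y$ be periodic first-derivative SBP operators on a two-dimensional tensor-product grid with diagonal mass (norm) matrix $M$. Let $g,\lambda$ be real constants and let $\boldsymbol{b}$ be a time-independent grid vector (bathymetry). Consider the semi-discretization (a system of ordinary differential equations in time $t$ for the grid vectors $\boldsymbol{h},\boldsymbol{u},\boldsymbol{v},\boldsymbol{w},\boldsymbol{\eta}$, with $\boldsymbol{h}$ componentwise positive) of the two-dimensional hyperbolic approximation of the Serre--Green--Naghdi equations with periodic boundary conditions given by $$\boldsymbol{h}_t + \boldsymbol{u}D_x \boldsymbol{h} + \boldsymbol{h}D_x\boldsymbol{u} + \boldsymbol{v}D_y \boldsymbol{h} + \boldsymbol{h}D_y\boldsymbol{v} = \boldsymbol{0},$$ $$\begin{aligned} &\boldsymbol{h}\boldsymbol{u}_t + gD_x(\boldsymbol{h}(\boldsymbol{h}+\boldsymbol{b})) - g(\boldsymbol{h}+\boldsymbol{b})D_x \boldsymbol{h} + \tfrac12\boldsymbol{h}D_x(\boldsymbol{u}^2) - \tfrac12\boldsymbol{u}^2 D_x \boldsymbol{h} + \tfrac12\boldsymbol{u}D_x(\boldsymbol{h}\boldsymbol{u}) - \tfrac12\boldsymbol{h}\boldsymbol{u}D_x \boldsymbol{u}\\ &\quad + \tfrac12 D_y(\boldsymbol{h}\boldsymbol{u}\boldsymbol{v}) - \tfrac12 \boldsymbol{u}\boldsymbol{v}D_y\boldsymbol{h} + \tfrac12 \boldsymbol{h}\boldsymbol{v}D_y \boldsymbol{u} - \tfrac12 \boldsymbol{h}\boldsymbol{u}D_y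 \boldsymbol{v}\\ &\quad + \tfrac{\lambda}{6}\tfrac{\boldsymbol{\eta}^{2}}{\boldsymbol{h}^{2}}D_x \boldsymbol{h} + \tfrac{\lambda}{3}D_x \boldsymbol{\eta} - \tfrac{\lambda}{3}\tfrac{\boldsymbol{\eta}}{\boldsymbol{h}}D_x \boldsymbol{\eta} - \tfrac{\lambda}{6}D_x\left(\tfrac{\boldsymbol{\eta}^{2}}{\boldsymbol{h}}\right) + \tfrac{\lambda}{2}\left(1-\tfrac{\boldsymbol{\eta}}{\boldsymbol{h}}\right)D_x \boldsymbol{b} = \boldsymbol{0}, \end{aligned}$$ $$\begin{aligned} &\boldsymbol{h}\boldsymbol{v}_t + gD_y(\boldsymbol{h}(\boldsymbol{h}+\boldsymbol{b})) - g(\boldsymbol{h}+\boldsymbol{b})D_y\boldsymbol{h} + \tfrac12\boldsymbol{h}D_y(\boldsymbol{v}^2) - \tfrac12\boldsymbol{v}^2 D_y \boldsymbol{h} + \tfrac12\boldsymbol{v}D_y(\boldsymbol{h}\boldsymbol{v}) - \tfrac12\boldsymbol{h}\boldsymbol{v}D_y \boldsymbol{v}\\ &\quad + \tfrac12 D_x(\boldsymbol{h}\boldsymbol{u}\boldsymbol{v}) - \tfrac12 \boldsymbol{u}\boldsymbol{v}D_x \boldsymbol{h} + \tfrac12 \boldsymbol{h}\boldsymbol{u}D_x \boldsymbol{v} - \tfrac12 \boldsymbol{h}\boldsymbol{v}D_x \boldsymbol{u}\\ &\quad + \tfrac{\lambda}{6}\tfrac{\boldsymbol{\eta}^{2}}{\boldsymbol{h}^{2}}D_y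 \boldsymbol{h} + \tfrac{\lambda}{3}D_y \boldsymbol{\eta} - \tfrac{\lambda}{3}\tfrac{\boldsymbol{\eta}}{\boldsymbol{h}}D_y \boldsymbol{\eta} - \tfrac{\lambda}{6}D_y\left(\tfrac{\boldsymbol{\eta}^{2}}{\boldsymbol{h}}\right) + \tfrac{\lambda}{2}\left(1-\tfrac{\boldsymbol{\eta}}{\boldsymbol{h}}\right)D_y \boldsymbol{b} = \boldsymbol{0}, \end{aligned}$$ $$\begin{aligned} &\boldsymbol{h}\boldsymbol{w}_t + \tfrac12D_x(\boldsymbol{h}\boldsymbol{u}\boldsymbol{w}) + \tfrac12\boldsymbol{h}\boldsymbol{u}D_x \boldsymbol{w} - \tfrac12\boldsymbol{u}\boldsymbol{w}D_x \boldsymbol{h} - \tfrac12\boldsymbol{h}\boldsymbol{w}D_x \boldsymbol{u}\\ &\quad + \tfrac12D_y(\boldsymbol{h}\boldsymbol{v}\boldsymbol{w}) + \tfrac12\boldsymbol{h}\boldsymbol{v}D_y \boldsymbol{w} - \tfrac12\boldsymbol{v}\boldsymbol{w}D_y \boldsymbol{h} - \tfrac12\boldsymbol{h}\boldsymbol{w}D_y \boldsymbol{v} = \lambda\left(1-\tfrac{\boldsymbol{\eta}}{\boldsymbol{h}}\right), \end{aligned}$$ $$\boldsymbol{\eta}_t + \boldsymbol{u}D_x \boldsymbol{\eta} + \boldsymbol{v}D_y \boldsymbol{\eta} + \tfrac32\boldsymbol{u}D_x \boldsymbol{b} + \tfrac32\boldsymbol{v}D_y \boldsymbol{b} = \boldsymbol{w}.$$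 Then, along every solution of this system: 1. the total water mass $\boldsymbol{1}^T M \boldsymbol{h}$ is conserved, i.e. $\frac{d}{dt}\left(\boldsymbol{1}^T M \boldsymbol{h}\right) = 0$; 2. the total energy $\boldsymbol{1}^T M \boldsymbol{E}$ is conserved, i.e. $\frac{d}{dt}\left(\boldsymbol{1}^T M \boldsymbol{E}\right)=0$, where $$\boldsymbol{E} = \boldsymbol{h}\left(\frac{\boldsymbol{u}^2+\boldsymbol{v}^2}{2} + \frac{1}{6}\boldsymbol{w}^2 + \frac{g}{2}(\boldsymbol{h}+2\boldsymbol{b}) + \frac{\lambda}{6}\left(\frac{\boldsymbol{\eta}}{\boldsymbol{h}}-1\right)^2\right).$$
   Context: Grid vectors: the domain is discretized by a tensor-product grid with $\mathcal{N}_x\times \mathcal{N}_y$ nodes; a grid vector is an element of $\mathbb{R}^{\mathcal{N}_x\mathcal{N}_y}$ of nodal values. All products, quotients, powers and other nonlinear operations of grid vectors are evaluated componentwise (e.g. $\boldsymbol{u}D_x\boldsymbol{h}$ is the componentwise product of $\boldsymbol{u}$ with the vector $D_x\boldsymbol{h}$); scalars such as $1$ in $1-\boldsymbol{\eta}/\boldsymbol{h}$ stand for constant vectors, and $\boldsymbol{1}=(1,\dots,1)^T$. The subscript $t$ denotes the time derivative. The matrices $D_x,D_y,M$ are constant in time. One-dimensional periodic SBP operator: a periodic first-derivative summation-by-parts (SBP) operator consists of a grid, a consistent first-derivative matrix $D$ (a matrix with at least $D\boldsymbol{1}=\boldsymbol{0}$) and a symmetric positive-definite matrix $M$ (mass or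 norm matrix) such that $MD+D^TM=0$. Two-dimensional operators: these are obtained from one-dimensional ones $(D_{1,x},M_x)$ and $(D_{1,y},M_y)$ with diagonal $M_x,M_y$ by tensor products, $D_x=D_{1,x}\otimes I$, $D_y=I\otimes D_{1,y}$, $M=M_x\otimes M_y$. In particular $M$ is diagonal with positive diagonal entries and $MD_x+D_x^TM=0$, $MD_y+D_y^TM=0$. Meaning of the variables: $h$ is the water height above the bathymetry $b$, $(u,v)$ is the velocity, $\eta,w$ are auxiliary variables, $g$ is the gravitational acceleration and $\lambda$ the relaxation parameter. *)

theory Defs
  imports "HOL-Analysis.Analysis"
begin

text \<open>A grid vector on a tensor-product grid is an element of \<^typ>\<open>real^('nx \<times> 'ny)\<close>, where
  \<^typ>\<open>'nx\<close> and \<^typ>\<open>'ny\<close> index the nodes in the two coordinate directions. On this type \<^term>\<open>(*)\<close>,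
  \<^term>\<open>(^)\<close> and \<^term>\<open>1\<close> are already the componentwise product, the componentwise power and the
  constant vector of ones; only the componentwise quotient is missing.\<close>

definition vdiv :: "real^'n \<Rightarrow> real^'n \<Rightarrow> real^'n" (infixl \<open>\<oslash>\<close> 70)
  where "x \<oslash> y = (\<chi> i. x $ i / y $ i)"

definition diagonal_matrix :: "real^'n^'n \<Rightarrow> bool"
  where "diagonal_matrix A \<longleftrightarrow> (\<forall>i j. i \<noteq> j \<longrightarrow> A $ i $ j = 0)"

definition sym_pos_def :: "real^'n^'n \<Rightarrow> bool"
  where "sym_pos_def A \<longleftrightarrow> transpose A = A \<and> (\<forall>x. x \<noteq> 0 \<longrightarrow> x \<bullet> (A *v x) > 0)"

text \<open>The positions of the grid nodes do not enter any of the conditions on the operators, so a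
  grid is represented by its index type alone.\<close>

definition periodic_SBP :: "real^'n^'n \<Rightarrow> real^'n^'n \<Rightarrow> bool"
  where "periodic_SBP D M \<longleftrightarrow>
    D *v 1 = 0 \<and> sym_pos_def M \<and> M ** D + transpose D ** M = 0"

definition kronecker :: "real^'n^'n \<Rightarrow> real^'m^'m \<Rightarrow> real^('n \<times> 'm)^('n \<times> 'm)"
    (infixl \<open>\<otimes>\<^sub>K\<close> 75)
  where "A \<otimes>\<^sub>K B = (\<chi> p q. A $ fst p $ fst q * B $ snd p $ snd q)"

text \<open>The five equations at one instant; \<^term>\<open>ht\<close>, \dots, \<^term>\<open>\<eta>t\<close> are the time derivatives.\<close>

definition sgn_semidiscretization ::
  "real^'n^'n \<Rightarrow> real^'n^'n \<Rightarrow> real \<Rightarrow> real \<Rightarrow> real^'n \<Rightarrow>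
   real^'n \<Rightarrow> real^'n \<Rightarrow> real^'n \<Rightarrow> real^'n \<Rightarrow> real^'n \<Rightarrow>
   real^'n \<Rightarrow> real^'n \<Rightarrow> real^'n \<Rightarrow> real^'n \<Rightarrow> real^'n \<Rightarrow> bool"
  where "sgn_semidiscretization Dx Dy g lam b h u v w \<eta> ht ut vt wt \<eta>t \<longleftrightarrow>
    ht + u * (Dx *v h) + h * (Dx *v u) + v * (Dy *v h) + h * (Dy *v v) = 0
  \<and>
    h * ut + g *\<^sub>R (Dx *v (h * (h + b))) - g *\<^sub>R ((h + b) * (Dx *v h))
      + (1/2) *\<^sub>R (h * (Dx *v u^2)) - (1/2) *\<^sub>R (u^2 * (Dx *v h))
      + (1/2) *\<^sub>R (u * (Dx *v (h * u))) - (1/2) *\<^sub>R (h * u * (Dx *v u))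
      + (1/2) *\<^sub>R (Dy *v (h * u * v)) - (1/2) *\<^sub>R (u * v * (Dy *v h))
      + (1/2) *\<^sub>R (h * v * (Dy *v u)) - (1/2) *\<^sub>R (h * u * (Dy *v v))
      + (lam/6) *\<^sub>R (\<eta>^2 \<oslash> h^2 * (Dx *v h)) + (lam/3) *\<^sub>R (Dx *v \<eta>)
      - (lam/3) *\<^sub>R (\<eta> \<oslash> h * (Dx *v \<eta>)) - (lam/6) *\<^sub>R (Dx *v (\<eta>^2 \<oslash> h))
      + (lam/2) *\<^sub>R ((1 - \<eta> \<oslash> h) * (Dx *v b)) = 0
  \<and>
    h * vt + g *\<^sub>R (Dy *v (h * (h + b))) - g *\<^sub>R ((h + b) * (Dy *v h))
      + (1/2) *\<^sub>R (h * (Dy *v v^2)) - (1/2) *\<^sub>R (v^2 * (Dy *v h))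
      + (1/2) *\<^sub>R (v * (Dy *v (h * v))) - (1/2) *\<^sub>R (h * v * (Dy *v v))
      + (1/2) *\<^sub>R (Dx *v (h * u * v)) - (1/2) *\<^sub>R (u * v * (Dx *v h))
      + (1/2) *\<^sub>R (h * u * (Dx *v v)) - (1/2) *\<^sub>R (h * v * (Dx *v u))
      + (lam/6) *\<^sub>R (\<eta>^2 \<oslash> h^2 * (Dy *v h)) + (lam/3) *\<^sub>R (Dy *v \<eta>)
      - (lam/3) *\<^sub>R (\<eta> \<oslash> h * (Dy *v \<eta>)) - (lam/6) *\<^sub>R (Dy *v (\<eta>^2 \<oslash> h))
      + (lam/2) *\<^sub>R ((1 - \<eta> \<oslash> h) * (Dy *v b)) = 0
  \<and>
    h * wt + (1/2) *\<^sub>R (Dx *v (h * u * w)) + (1/2) *\<^sub>R (h * u * (Dx *v w))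
      - (1/2) *\<^sub>R (u * w * (Dx *v h)) - (1/2) *\<^sub>R (h * w * (Dx *v u))
      + (1/2) *\<^sub>R (Dy *v (h * v * w)) + (1/2) *\<^sub>R (h * v * (Dy *v w))
      - (1/2) *\<^sub>R (v * w * (Dy *v h)) - (1/2) *\<^sub>R (h * w * (Dy *v v))
      = lam *\<^sub>R (1 - \<eta> \<oslash> h)
  \<and>
    \<eta>t + u * (Dx *v \<eta>) + v * (Dy *v \<eta>)
      + (3/2) *\<^sub>R (u * (Dx *v b)) + (3/2) *\<^sub>R (v * (Dy *v b)) = w"

text \<open>Solutions live on a nondegenerate time interval \<^term>\<open>T\<close> of any kind; at an endpoint
  belonging to \<^term>\<open>T\<close> the time derivative is one-sided.\<close>

definition sgn_solution ::
  "real^'n^'n \<Rightarrow> real^'n^'n \<Rightarrow> real \<Rightarrow> real \<Rightarrow> real^'n \<Rightarrow> real set \<Rightarrow>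
   (real \<Rightarrow> real^'n) \<Rightarrow> (real \<Rightarrow> real^'n) \<Rightarrow> (real \<Rightarrow> real^'n) \<Rightarrow>
   (real \<Rightarrow> real^'n) \<Rightarrow> (real \<Rightarrow> real^'n) \<Rightarrow> bool"
  where "sgn_solution Dx Dy g lam b T h u v w \<eta> \<longleftrightarrow>
    is_interval T \<and> interior T \<noteq> {} \<and>
    h differentiable_on T \<and> u differentiable_on T \<and> v differentiable_on T \<and>
    w differentiable_on T \<and> \<eta> differentiable_on T \<and>
    (\<forall>t\<in>T. (\<forall>i. h t $ i > 0) \<and>
      sgn_semidiscretization Dx Dy g lam b (h t) (u t) (v t) (w t) (\<eta> t)
        (vector_derivative h (at t within T)) (vector_derivative u (at t within T))
        (vector_derivative v (at t within T)) (vector_derivative w (at t within T))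
        (vector_derivative \<eta> (at t within T)))"

definition sgn_energy ::
  "real \<Rightarrow> real \<Rightarrow> real^'n \<Rightarrow> real^'n \<Rightarrow> real^'n \<Rightarrow> real^'n \<Rightarrow> real^'n \<Rightarrow> real^'n \<Rightarrow> real^'n"
  where "sgn_energy g lam b h u v w \<eta> =
    h * ((1/2) *\<^sub>R (u^2 + v^2) + (1/6) *\<^sub>R w^2 + (g/2) *\<^sub>R (h + 2 * b)
      + (lam/6) *\<^sub>R (\<eta> \<oslash> h - 1)^2)"

end

theory Submission
  imports Defs
begin

text \<open>Since the mass matrix is diagonal, every total is a weighted nodal sum, and the
  summation-by-parts property says that the weighted sum of \<open>a D c + c D a\<close> vanishes for all grid
  vectors \<open>a\<close> and \<open>c\<close>. The split form of the equations is chosen so that the nodal rate of change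
  of the energy is a linear combination of such pairs with constant coefficients: no product or
  chain rule for the difference operators is needed.\<close>

lemma inner_one_diagonal:
  fixes A :: "real^'n^'n"
  assumes "diagonal_matrix A"
  shows "1 \<bullet> (A *v x) = (\<Sum>i\<in>UNIV. A $ i $ i * x $ i)"
proof -
  have "(\<Sum>j\<in>UNIV. A $ i $ j * x $ j) = (\<Sum>j\<in>UNIV. if j = i then A $ i $ i * x $ i else 0)" for i
    using assms by (intro sum.cong) (auto simp: diagonal_matrix_def)
  then show ?thesis
    by (simp add: inner_vec_def matrix_vector_mult_def)
qed

lemma diagonal_kronecker:
  assumes "diagonal_matrix A" "diagonal_matrix B"
  shows "diagonal_matrix (A \<otimes>\<^sub>K B)"
  using assms by (fastforce simp: diagonal_matrix_def kronecker_def prod_eq_iff)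

text \<open>Entrywise skew-symmetry of \<open>M ** D\<close> when \<open>M\<close> is diagonal.
  Since only single entries occur and no matrix products, the property can be transferred to
  Kronecker products index by index.\<close>

definition diag_SBP :: "real^'n^'n \<Rightarrow> real^'n^'n \<Rightarrow> bool"
  where "diag_SBP D M \<longleftrightarrow> (\<forall>i j. M $ i $ i * D $ i $ j + M $ j $ j * D $ j $ i = 0)"

lemma periodic_SBP_imp_diag_SBP:
  assumes "periodic_SBP D M" "diagonal_matrix M"
  shows "diag_SBP D M"
  unfolding diag_SBP_def
proof (intro allI)
  fix i j
  have "(\<Sum>k\<in>UNIV. M $ i $ k * D $ k $ j) = (\<Sum>k\<in>UNIV. if k = i then M $ i $ i * D $ i $ j else 0)"
    and "(\<Sum>k\<in>UNIV. D $ k $ i * M $ k $ j) = (\<Sum>k\<in>UNIV. if k = j then D $ j $ i * M $ j $ j else 0)"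
    using assms(2) by (intro sum.cong refl; auto simp: diagonal_matrix_def)+
  moreover have "(M ** D + transpose D ** M) $ i $ j = 0"
    using assms(1) by (simp add: periodic_SBP_def)
  ultimately show "M $ i $ i * D $ i $ j + M $ j $ j * D $ j $ i = 0"
    by (simp add: matrix_matrix_mult_def transpose_def mult.commute)
qed

text \<open>If \<open>snd p\<close> and \<open>snd q\<close> differ, the identity factor kills both
  terms. If they agree, both terms share the factor \<open>N $ snd p $ snd p\<close>, and the
  one-dimensional identity remains.\<close>

lemma diag_SBP_kronecker_left:
  assumes "diag_SBP D M"
  shows "diag_SBP (D \<otimes>\<^sub>K mat 1) (M \<otimes>\<^sub>K N)"
  unfolding diag_SBP_def
proof (intro allI)
  fix p q :: "'a \<times> 'b"
  have "N $ snd p $ snd p * (M $ fst p $ fst p * D $ fst p $ fst q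
      + M $ fst q $ fst q * D $ fst q $ fst p) = 0"
    using assms by (simp add: diag_SBP_def)
  then show "(M \<otimes>\<^sub>K N) $ p $ p * (D \<otimes>\<^sub>K mat 1) $ p $ q
      + (M \<otimes>\<^sub>K N) $ q $ q * (D \<otimes>\<^sub>K mat 1) $ q $ p = 0"
    by (cases "snd p = snd q") (simp_all add: kronecker_def mat_def algebra_simps)
qed

lemma diag_SBP_kronecker_right:
  assumes "diag_SBP D N"
  shows "diag_SBP (mat 1 \<otimes>\<^sub>K D) (M \<otimes>\<^sub>K N)"
  unfolding diag_SBP_def
proof (intro allI)
  fix p q :: "'b \<times> 'a"
  have "M $ fst p $ fst p * (N $ snd p $ snd p * D $ snd p $ snd q
      + N $ snd q $ snd q * D $ snd q $ snd p) = 0"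
    using assms by (simp add: diag_SBP_def)
  then show "(M \<otimes>\<^sub>K N) $ p $ p * (mat 1 \<otimes>\<^sub>K D) $ p $ q
      + (M \<otimes>\<^sub>K N) $ q $ q * (mat 1 \<otimes>\<^sub>K D) $ q $ p = 0"
    by (cases "fst p = fst q") (simp_all add: kronecker_def mat_def algebra_simps)
qed

text \<open>The discrete stand-in for the derivative of the product \<open>a * c\<close>, as the
  product rule would expand it.\<close>

definition sbp_pair :: "real^'n^'n \<Rightarrow> real^'n \<Rightarrow> real^'n \<Rightarrow> 'n \<Rightarrow> real"
  where "sbp_pair D a c i = a $ i * (D *v c) $ i + c $ i * (D *v a) $ i"

text \<open>Discrete integration by parts without boundary terms: in the double sum for
  \<open>c D a\<close>, exchanging the two indices and using skew-symmetry gives minus the double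
  sum for \<open>a D c\<close>.\<close>

lemma weighted_sum_sbp_pair:
  assumes "diag_SBP D M"
  shows "(\<Sum>i\<in>UNIV. M $ i $ i * sbp_pair D a c i) = 0"
proof -
  have "(\<Sum>i\<in>UNIV. M $ i $ i * (c $ i * (D *v a) $ i))
      = (\<Sum>i\<in>UNIV. \<Sum>j\<in>UNIV. M $ i $ i * D $ i $ j * c $ i * a $ j)"
    by (simp add: matrix_vector_mult_def sum_distrib_left algebra_simps)
  also have "\<dots> = (\<Sum>j\<in>UNIV. \<Sum>i\<in>UNIV. M $ i $ i * D $ i $ j * c $ i * a $ j)"
    by (rule sum.swap)
  also have "\<dots> = (\<Sum>j\<in>UNIV. \<Sum>i\<in>UNIV. - (M $ j $ j * (a $ j * (D $ j $ i * c $ i))))"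
  proof (intro sum.cong refl)
    fix i j
    have "M $ i $ i * D $ i $ j = - (M $ j $ j * D $ j $ i)"
      using assms unfolding diag_SBP_def by (metis add_eq_0_iff2)
    then show "M $ i $ i * D $ i $ j * c $ i * a $ j = - (M $ j $ j * (a $ j * (D $ j $ i * c $ i)))"
      by simp
  qed
  also have "\<dots> = - (\<Sum>j\<in>UNIV. M $ j $ j * (a $ j * (D *v c) $ j))"
    by (simp add: matrix_vector_mult_def sum_distrib_left sum_negf)
  finally show ?thesis
    by (simp add: sbp_pair_def distrib_left sum.distrib)
qed

lemma vec_nth_power [simp]: "(x ^ n) $ i = (x $ i) ^ n"
  by (induction n) simp_all

lemma has_real_derivative_weighted_sum:
  fixes m :: "'n::finite \<Rightarrow> real"
  assumes "\<And>i. ((\<lambda>t. f t i) has_real_derivative f' i) (at t within T)"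
  shows "((\<lambda>t. \<Sum>i\<in>UNIV. m i * f t i) has_real_derivative (\<Sum>i\<in>UNIV. m i * f' i)) (at t within T)"
  by (intro DERIV_sum DERIV_cmult assms)

lemma has_real_derivative_vec_nth:
  fixes f :: "real \<Rightarrow> real^'n"
  assumes "f differentiable_on T" "t \<in> T"
  shows "((\<lambda>t. f t $ i) has_real_derivative vector_derivative f (at t within T) $ i) (at t within T)"
proof -
  have "(f has_vector_derivative vector_derivative f (at t within T)) (at t within T)"
    using assms by (simp add: differentiable_on_def vector_derivative_works[symmetric])
  from bounded_linear.has_vector_derivative[OF bounded_linear_vec_nth this]
  show ?thesis
    by (simp add: has_real_derivative_iff_has_vector_derivative)
qed

text \<open>The products \<open>h t * u'\<close>, \<open>h t * v'\<close> and
  \<open>h t * w'\<close> are kept together because these are what the evolution equations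
  determine. The factor \<open>1 - (\<eta> t / h t)^2\<close> arises from expanding the relaxation
  energy as \<open>\<eta>^2 / h - 2 * \<eta> + h\<close> and differentiating in
  \<open>h\<close>.\<close>

lemma energy_density_deriv:
  fixes h u v w \<eta> :: "real \<Rightarrow> real"
  assumes "h t > 0"
    and "(h has_real_derivative h') (at t within T)" "(u has_real_derivative u') (at t within T)"
    "(v has_real_derivative v') (at t within T)" "(w has_real_derivative w') (at t within T)"
    "(\<eta> has_real_derivative \<eta>') (at t within T)"
  shows "((\<lambda>t. h t * (((u t)^2 + (v t)^2) / 2 + (w t)^2 / 6 + g / 2 * (h t + 2 * b)
      + lam / 6 * (\<eta> t / h t - 1)^2)) has_real_derivative
    ((u t)^2 + (v t)^2) / 2 * h' + (w t)^2 / 6 * h' + g * (h t + b) * h'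
      + lam / 6 * (1 - (\<eta> t / h t)^2) * h' + u t * (h t * u') + v t * (h t * v')
      + w t / 3 * (h t * w') + lam / 3 * (\<eta> t / h t - 1) * \<eta>') (at t within T)"
  by (insert assms, (rule derivative_eq_intros refl | simp)+)
    (simp add: field_simps power2_eq_square)

text \<open>A pointwise algebraic identity in which each nodal value of a difference operator is an
  independent unknown. The terms with differences of \<eta> and of \<open>b\<close>, and the
  relaxation source against \<open>w\<close>, cancel between the momentum, \<open>w\<close> and
  \<eta> equations; everything else groups into pairs.\<close>

lemma energy_rate_eq_pairs:
  assumes pos: "\<And>i. h $ i > 0"
    and eqs: "sgn_semidiscretization Dx Dy g lam b h u v w \<eta> ht ut vt wt \<eta>t"
  shows "((u $ i)^2 + (v $ i)^2) / 2 * ht $ i + (w $ i)^2 / 6 * ht $ i + g * (h $ i + b $ i) * ht $ i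
      + lam / 6 * (1 - (\<eta> $ i / h $ i)^2) * ht $ i + u $ i * (h $ i * ut $ i)
      + v $ i * (h $ i * vt $ i) + w $ i / 3 * (h $ i * wt $ i)
      + lam / 3 * (\<eta> $ i / h $ i - 1) * \<eta>t $ i
    = - g * sbp_pair Dx u (h * (h + b)) i - 1/2 * sbp_pair Dx (h * u) (u^2) i
      - 1/2 * sbp_pair Dx v (h * u * v) i - 1/6 * sbp_pair Dx w (h * u * w) i
      + lam/6 * sbp_pair Dx u (\<eta>^2 \<oslash> h) i - lam/6 * sbp_pair Dx u h i
      - g * sbp_pair Dy v (h * (h + b)) i - 1/2 * sbp_pair Dy (h * v) (v^2) i
      - 1/2 * sbp_pair Dy u (h * u * v) i - 1/6 * sbp_pair Dy w (h * v * w) i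
      + lam/6 * sbp_pair Dy v (\<eta>^2 \<oslash> h) i - lam/6 * sbp_pair Dy v h i"
proof -
  \<comment> \<open>With \<eta> written as \<open>q * h\<close> at the node, all quotients disappear
    and the identity becomes polynomial.\<close>
  define q where "q = \<eta> $ i / h $ i"
  have \<eta>: "\<eta> $ i = q * h $ i"
    using pos[of i] by (simp add: q_def)
  have q2: "(\<eta>^2 \<oslash> h) $ i = q^2 * h $ i" "(\<eta>^2 \<oslash> h^2) $ i = q^2" "(\<eta> \<oslash> h) $ i = q"
    using pos[of i] by (simp_all add: vdiv_def q_def power2_eq_square)
  note eqs_i = eqs[unfolded sgn_semidiscretization_def vec_eq_iff zero_index]
  note eq1 = eqs_i[THEN conjunct1, rule_format, of i]
    and eq2 = eqs_i[THEN conjunct2, THEN conjunct1, rule_format, of i]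
    and eq3 = eqs_i[THEN conjunct2, THEN conjunct2, THEN conjunct1, rule_format, of i]
    and eq4 = eqs_i[THEN conjunct2, THEN conjunct2, THEN conjunct2, THEN conjunct1, rule_format, of i]
    and eq5 = eqs_i[THEN conjunct2, THEN conjunct2, THEN conjunct2, THEN conjunct2, rule_format, of i]
  \<comment> \<open>The multipliers are the partial derivatives of the energy density, up to the factor \<open>h\<close>
    already present in front of \<open>u\<^sub>t\<close>, \<open>v\<^sub>t\<close> and \<open>w\<^sub>t\<close>.\<close>
  note combination = arg_cong[OF eq1, of "\<lambda>x. (((u $ i)^2 + (v $ i)^2) / 2 + (w $ i)^2 / 6
      + g * (h $ i + b $ i) + lam / 6 * (1 - q^2)) * x"]
    arg_cong[OF eq2, of "\<lambda>x. u $ i * x"] arg_cong[OF eq3, of "\<lambda>x. v $ i * x"]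
    arg_cong[OF eq4, of "\<lambda>x. w $ i / 3 * x"] arg_cong[OF eq5, of "\<lambda>x. lam / 3 * (q - 1) * x"]
  note components = vector_add_component vector_minus_component vector_scaleR_component
    vector_mult_component vec_nth_power one_index real_scaleR_def
  show ?thesis
    using combination
    unfolding q_def[symmetric] sbp_pair_def components q2
    \<comment> \<open>After full expansion the monomials act as atoms, so the goal is a linear
      consequence of the five multiplied equations.\<close>
    by (simp only: algebra_simps power2_eq_square \<eta> mult_zero_right) argo
qed

theorem theorem4p1:
  fixes D1x Mx :: "real^'nx^'nx" and D1y My :: "real^'ny^'ny"
    and Dx Dy M :: "real^('nx \<times> 'ny)^('nx \<times> 'ny)"
    and g lam :: real and b :: "real^('nx \<times> 'ny)" and T :: "real set"
    and h u v w \<eta> :: "real \<Rightarrow> real^('nx \<times> 'ny)"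
  assumes "periodic_SBP D1x Mx" and "diagonal_matrix Mx"
    and "periodic_SBP D1y My" and "diagonal_matrix My"
    and "Dx = D1x \<otimes>\<^sub>K mat 1" and "Dy = mat 1 \<otimes>\<^sub>K D1y" and "M = Mx \<otimes>\<^sub>K My"
    and "sgn_solution Dx Dy g lam b T h u v w \<eta>"
  shows "\<forall>t\<in>T.
    ((\<lambda>t. 1 \<bullet> (M *v h t)) has_real_derivative 0) (at t within T) \<and>
    ((\<lambda>t. 1 \<bullet> (M *v sgn_energy g lam b (h t) (u t) (v t) (w t) (\<eta> t)))
       has_real_derivative 0) (at t within T)"
proof (intro ballI conjI)
  fix t assume t: "t \<in> T"
  let ?d = "\<lambda>f. vector_derivative f (at t within T)"
  have M: "diagonal_matrix M"
    using assms(2,4,7) by (simp add: diagonal_kronecker)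
  have "diag_SBP Dx M" "diag_SBP Dy M"
    using assms(1-7) by (simp_all add: diag_SBP_kronecker_left diag_SBP_kronecker_right
        periodic_SBP_imp_diag_SBP)
  then have pairs: "(\<Sum>i\<in>UNIV. M $ i $ i * sbp_pair Dx a c i) = 0"
      "(\<Sum>i\<in>UNIV. M $ i $ i * sbp_pair Dy a c i) = 0" for a c
    by (simp_all add: weighted_sum_sbp_pair)
  have pos: "h t $ i > 0" for i
    using assms(8) t unfolding sgn_solution_def by blast
  have sys: "sgn_semidiscretization Dx Dy g lam b (h t) (u t) (v t) (w t) (\<eta> t)
      (?d h) (?d u) (?d v) (?d w) (?d \<eta>)"
    using assms(8) t by (simp add: sgn_solution_def)
  have deriv: "((\<lambda>t. f t $ i) has_real_derivative ?d f $ i) (at t within T)"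
    if "f \<in> {h, u, v, w, \<eta>}" for f i
    using assms(8) t that by (intro has_real_derivative_vec_nth) (auto simp: sgn_solution_def)

  \<comment> \<open>The mass equation already has pair form: its flux terms are the pairs of
    \<open>h\<close> with \<open>u\<close> in x and of \<open>h\<close> with \<open>v\<close> in
    y.\<close>
  have "(?d h + u t * (Dx *v h t) + h t * (Dx *v u t) + v t * (Dy *v h t) + h t * (Dy *v v t)) $ i = 0"
    for i using sys by (simp add: sgn_semidiscretization_def)
  then have "?d h $ i = - sbp_pair Dx (h t) (u t) i - sbp_pair Dy (h t) (v t) i" for i
    by (simp add: sbp_pair_def add_eq_0_iff2 algebra_simps)
  then have "((\<lambda>t. h t $ i) has_real_derivative
      - sbp_pair Dx (h t) (u t) i - sbp_pair Dy (h t) (v t) i) (at t within T)" for i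
    using deriv[of h i] by simp
  from has_real_derivative_weighted_sum[where
      f = "\<lambda>t i. h t $ i" and m = "\<lambda>i. M $ i $ i", OF this]
  show "((\<lambda>t. 1 \<bullet> (M *v h t)) has_real_derivative 0) (at t within T)"
    by (simp add: inner_one_diagonal[OF M] right_diff_distrib sum_subtractf sum_negf pairs)

  have "((\<lambda>t. sgn_energy g lam b (h t) (u t) (v t) (w t) (\<eta> t) $ i) has_real_derivative
      - g * sbp_pair Dx (u t) (h t * (h t + b)) i - 1/2 * sbp_pair Dx (h t * u t) ((u t)^2) i
      - 1/2 * sbp_pair Dx (v t) (h t * u t * v t) i - 1/6 * sbp_pair Dx (w t) (h t * u t * w t) i
      + lam/6 * sbp_pair Dx (u t) ((\<eta> t)^2 \<oslash> h t) i - lam/6 * sbp_pair Dx (u t) (h t) i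
      - g * sbp_pair Dy (v t) (h t * (h t + b)) i - 1/2 * sbp_pair Dy (h t * v t) ((v t)^2) i
      - 1/2 * sbp_pair Dy (u t) (h t * u t * v t) i - 1/6 * sbp_pair Dy (w t) (h t * v t * w t) i
      + lam/6 * sbp_pair Dy (v t) ((\<eta> t)^2 \<oslash> h t) i - lam/6 * sbp_pair Dy (v t) (h t) i)
      (at t within T)" for i
    \<comment> \<open>The chain rule is used in time only, node by node; the equations then turn the
      resulting rate into pairs.\<close>
    using energy_density_deriv[where h = "\<lambda>t. h t $ i" and b = "b $ i" and g = g and lam = lam,
        OF pos deriv[of h i] deriv[of u i] deriv[of v i] deriv[of w i] deriv[of \<eta> i]]
    unfolding energy_rate_eq_pairs[OF pos sys]
    by (simp add: sgn_energy_def vdiv_def)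
  from has_real_derivative_weighted_sum[where
      f = "\<lambda>t. vec_nth (sgn_energy g lam b (h t) (u t) (v t) (w t) (\<eta> t))"
      and m = "\<lambda>i. M $ i $ i", OF this]
  show "((\<lambda>t. 1 \<bullet> (M *v sgn_energy g lam b (h t) (u t) (v t) (w t) (\<eta> t)))
      has_real_derivative 0) (at t within T)"
    \<comment> \<open>The constant coefficients are moved in front of the mass weights and out of
      the sums, leaving weighted sums of single pairs, all zero.\<close>
    by (simp add: inner_one_diagonal[OF M] right_diff_distrib distrib_left sum.distrib sum_subtractf
        sum_negf mult.left_commute[of "M $ _ $ _"] sum_distrib_left[symmetric]
        sum_divide_distrib[symmetric] pairs)
qed

end
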